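(* Let $d=1$, $p>1$ and $q=2p-1$. Then $\eta_0$ is expressed as $$\eta_0(x)=\frac{1}{(p-1)(p+1)}\left(\frac{2(p+1)}{\frac{(p+1)^2}{p}+(p-1)^2x^2}\right)^{\frac1{p-1}+1}\left(\frac{(p+1)^4}{8p^2}-\frac{(p-1)^2(p+1)^2}{4p}x^2-\frac{(p-1)^4}{24}x^4\right)$$ for $x\in\mathbb{R}$. In particular, $\eta_0(x)\sim-|x|^{-\frac{2}{p-1}+2}$ as $|x|\to\infty$.
   Context: For $\omega\ge 0$, $\phi_\omega$ denotes the unique positive, even, decreasing (and decaying to $0$ at infinity) solution on $\mathbb{R}$ of $-\phi''+\omega\phi+|\phi|^{p-1}\phi-|\phi|^{q-1}\phi=0$. For $\omega>0$, $\eta_\omega:=\partial_\omega\phi_\omega$, and $\eta_0(x):=\lim_{\omega\downarrow0}\eta_\omega(x)$ for $x\in\mathbb{R}$ (the pointwise limit exists). When $q=2p-1$ the following is known: $$\phi_\omega(x)=\left(\frac{(p+1)\omega}{\sqrt{1+\frac{(p+1)^2}{p}\omega}\,\cosh((p-1)\sqrt{\omega}\,x)-1}\right)^{1/(p-1)}\ (\omega>0),\qquad \phi_0(x)=\left(\frac{2(p+1)}{\frac{(p+1)^2}{p}+(p-1)^2x^2}\right)^{1/(p-1)}.$$ Notation: $f\sim g$ means that $f/g$ converges to a positive constant in the stated limit. *)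

theory Defs
  imports "HOL-Analysis.Analysis"
begin

text \<open>
  Ground states of the one-dimensional double power equation
  \<open>- f'' + \<omega> f + |f|^(p-1) f - |f|^(q-1) f = 0\<close>: classical solutions on the whole line that are
  positive, even, decreasing in \<open>|x|\<close>, and vanish at infinity.
\<close>
definition ground_state :: "real \<Rightarrow> real \<Rightarrow> real \<Rightarrow> (real \<Rightarrow> real) \<Rightarrow> bool" where
  "ground_state p q \<omega> f \<longleftrightarrow>
     (\<forall>x. f differentiable (at x)) \<and>
     (\<forall>x. deriv f differentiable (at x)) \<and>
     (\<forall>x. - deriv (deriv f) x + \<omega> * f x
            + \<bar>f x\<bar> powr (p - 1) * f x - \<bar>f x\<bar> powr (q - 1) * f x = 0) \<and>
     (\<forall>x. f x > 0) \<and>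
     (\<forall>x. f (- x) = f x) \<and>
     strict_antimono_on {0..} f \<and>
     (f \<longlongrightarrow> 0) at_infinity"

definition phi :: "real \<Rightarrow> real \<Rightarrow> real \<Rightarrow> real \<Rightarrow> real" where
  "phi p q \<omega> = (THE f. ground_state p q \<omega> f)"

definition eta :: "real \<Rightarrow> real \<Rightarrow> real \<Rightarrow> real \<Rightarrow> real" where
  "eta p q \<omega> x = deriv (\<lambda>w. phi p q w x) \<omega>"

text \<open>The limit profile is not \<open>eta p q 0\<close> but the one-sided pointwise limit as \<open>\<omega>\<close> decreases to 0.\<close>
definition eta0 :: "real \<Rightarrow> real \<Rightarrow> real \<Rightarrow> real" where
  "eta0 p q x = Lim (at_right 0) (\<lambda>\<omega>. eta p q \<omega> x)"

text \<open>
  Asymptotic comparability: the quotient tends to a positive constant, not necessarily 1 (so this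
  is weaker than \<open>asymp_equiv\<close>). It fixes the sign of \<open>f\<close> relative to \<open>g\<close>.
\<close>
definition asymp_comparable :: "(real \<Rightarrow> real) \<Rightarrow> (real \<Rightarrow> real) \<Rightarrow> real filter \<Rightarrow> bool" where
  "asymp_comparable f g F \<longleftrightarrow> (\<exists>c>0. ((\<lambda>x. f x / g x) \<longlongrightarrow> c) F)"

end

theory Submission
  imports Defs "HOL-Real_Asymp.Real_Asymp"
begin

text \<open>
  A ground state \<open>f\<close> has zero energy, since \<open>f\<close> and, along a sequence, \<open>f'\<close> vanish at infinity.
  For \<open>q = 2 p - 1\<close> this first integral turns the equation into the linear one
  \<open>v'' = (p - 1)\<^sup>2 (\<omega> v + 1 / (p + 1))\<close> for \<open>v = f powr (1 - p)\<close>; evenness gives \<open>v'(0) = 0\<close>, and the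
  first integral at \<open>0\<close> is a quadratic equation with a single positive root \<open>v(0)\<close>. Hence the ground
  state is unique and explicit, and \<open>\<eta>\<^sub>0\<close> is read off the expansion of \<open>v\<close> to first order in \<open>\<omega>\<close>.
\<close>

section \<open>The equation without absolute values and its first integral\<close>

lemma ground_state_derivs:
  assumes "ground_state p q w f"
  shows "(f has_real_derivative deriv f x) (at x)"
    and "(deriv f has_real_derivative
           (w * f x + f x powr p - f x powr q)) (at x)"
    and "f x > 0"
proof -
  have f: "f differentiable (at x)" "deriv f differentiable (at x)" "f x > 0"
    and eq: "- deriv (deriv f) x + w * f x
            + \<bar>f x\<bar> powr (p - 1) * f x - \<bar>f x\<bar> powr (q - 1) * f x = 0"
    using assms unfolding ground_state_def by blast+
  show "(f has_real_derivative deriv f x) (at x)" "f x > 0"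
    using f by (simp_all add: DERIV_deriv_iff_real_differentiable)
  have "f x powr (a - 1) * f x = f x powr a" for a
    using f(3) by (simp add: powr_diff)
  then have "deriv (deriv f) x = w * f x + f x powr p - f x powr q"
    using eq f(3) by simp
  then show "(deriv f has_real_derivative
           (w * f x + f x powr p - f x powr q)) (at x)"
    using f(2) by (metis DERIV_deriv_iff_real_differentiable)
qed

lemma even_imp_deriv_0:
  fixes f :: "real \<Rightarrow> real"
  assumes f: "\<And>x. f (- x) = f x" and d: "(f has_real_derivative D) (at 0)"
  shows "D = 0"
proof -
  have "(f \<circ> uminus has_real_derivative D * -1) (at 0)"
    by (rule DERIV_chain) (use d in \<open>auto intro!: derivative_eq_intros\<close>)
  moreover have "f \<circ> uminus = f" using f by auto
  ultimately have "D * -1 = D" using d DERIV_unique by metis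
  then show ?thesis by simp
qed

text \<open>Multiplied by \<open>2 * deriv f\<close>, the equation becomes an exact derivative, so
  the difference \<open>E\<close> of the two sides is constant. Its value 0 is read off along a
  sequence going to infinity.\<close>

lemma ground_state_energy:
  assumes gs: "ground_state p q w f" and "p > 1" "q > 1"
  shows "(deriv f x)\<^sup>2 = w * (f x)\<^sup>2 + 2 * f x powr (p + 1) / (p + 1) - 2 * f x powr (q + 1) / (q + 1)"
proof -
  note D = ground_state_derivs[OF gs]
  define G where "G = (\<lambda>y. w * (f y)\<^sup>2 + 2 * f y powr (p + 1) / (p + 1) - 2 * f y powr (q + 1) / (q + 1))"
  define E where "E = (\<lambda>y. (deriv f y)\<^sup>2 - G y)"
  have dpow: "((\<lambda>y. 2 * f y powr (a + 1) / (a + 1)) has_real_derivative 2 * f y powr a * deriv f y) (at y)"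
    if "a > 1" for a y
    using that D(3)[of y]
    by (auto intro!: derivative_eq_intros D(1))
  have "(E has_real_derivative 0) (at y)" for y
    unfolding E_def G_def
    by (rule derivative_eq_intros D(1,2) dpow assms(2,3) refl | simp add: algebra_simps)+
  then have const: "E y = E x" for y
    using DERIV_isconst_all by blast
  have f0: "(f \<longlongrightarrow> 0) at_top"
    using gs at_top_le_at_infinity unfolding ground_state_def by (metis tendsto_mono)
  \<comment> \<open>Decay of \<open>deriv f\<close> is not part of being a ground state. The mean
    value theorem supplies points beyond \<open>n\<close> where \<open>deriv f\<close> equals an
    increment of \<open>f\<close>, and these increments tend to 0.\<close>
  have "\<exists>\<xi>. real n < \<xi> \<and> deriv f \<xi> = f (real n + 1) - f (real n)" for n
    using MVT2[of "real n" "real n + 1" f "deriv f"] D(1) by force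
  then obtain \<xi> where \<xi>: "\<And>n. real n < \<xi> n" "\<And>n. deriv f (\<xi> n) = f (real n + 1) - f (real n)"
    by metis
  have lin: "filterlim \<xi> at_top sequentially"
    by (rule filterlim_at_top_mono[OF filterlim_real_sequentially])
       (use \<xi>(1) in \<open>auto intro: always_eventually less_imp_le\<close>)
  have fx: "(\<lambda>n. f (\<xi> n)) \<longlonglongrightarrow> 0"
    using filterlim_compose[OF f0 lin] .
  have s: "(\<lambda>n. f (real n)) \<longlonglongrightarrow> 0"
    using filterlim_compose[OF f0 filterlim_real_sequentially] .
  have s1: "(\<lambda>n. f (real n + 1)) \<longlonglongrightarrow> 0"
    by (rule filterlim_compose[OF f0]) real_asymp
  have d: "(\<lambda>n. deriv f (\<xi> n)) \<longlonglongrightarrow> 0"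
    unfolding \<xi>(2) using tendsto_diff[OF s1 s] by simp
  have fp: "(\<lambda>n. f (\<xi> n) powr (a + 1)) \<longlonglongrightarrow> 0" if "a > 1" for a
    by (rule tendsto_zero_powrI[OF fx tendsto_const]) (use that D(3) in \<open>auto intro: always_eventually less_imp_le\<close>)
  have "(\<lambda>n. E (\<xi> n)) \<longlonglongrightarrow> 0\<^sup>2 - (w * 0\<^sup>2 + 2 * 0 / (p + 1) - 2 * 0 / (q + 1))"
    unfolding E_def G_def using assms(2,3)
    by (intro tendsto_intros d fx fp) auto
  moreover have "(\<lambda>n. E (\<xi> n)) = (\<lambda>n. E x)" using const by blast
  ultimately have "(\<lambda>n. E x) \<longlonglongrightarrow> 0" by simp
  then have "E x = 0" by (simp add: LIMSEQ_const_iff)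
  then show ?thesis by (simp add: E_def G_def)
qed

section \<open>Uniqueness and closed form of the ground state for q = 2p - 1\<close>

text \<open>The pair \<open>(k * u, u')\<close> moves by hyperbolic rotation through the angle
  \<open>k * x\<close>. Rotating it back gives the conserved quantities \<open>A\<close> and
  \<open>B\<close>, and rotating \<open>(A 0, B 0)\<close> forward again recovers
  \<open>u\<close>.\<close>

lemma cosh_ODE_unique:
  fixes u u' :: "real \<Rightarrow> real"
  assumes u: "\<And>x. (u has_real_derivative u' x) (at x)"
    and u': "\<And>x. (u' has_real_derivative k\<^sup>2 * u x) (at x)"
    and "u' 0 = 0" "k \<noteq> 0"
  shows "u x = u 0 * cosh (k * x)"
proof -
  define A where "A = (\<lambda>x. k * u x * cosh (k * x) - u' x * sinh (k * x))"
  define B where "B = (\<lambda>x. u' x * cosh (k * x) - k * u x * sinh (k * x))"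
  have "(A has_real_derivative 0) (at x)" "(B has_real_derivative 0) (at x)" for x
    unfolding A_def B_def
    by (auto intro!: derivative_eq_intros u u' simp: algebra_simps power2_eq_square)
  then have "A x = A 0" "B x = B 0"
    by (metis DERIV_isconst_all)+
  then have a: "A x = k * u 0" and b: "B x = 0"
    using \<open>u' 0 = 0\<close> by (simp_all add: A_def B_def)
  have "A x * cosh (k * x) + B x * sinh (k * x) = k * u x * ((cosh (k * x))\<^sup>2 - (sinh (k * x))\<^sup>2)"
    unfolding A_def B_def by (simp add: algebra_simps power2_eq_square)
  also have "\<dots> = k * u x" by (simp add: cosh_square_eq)
  finally show ?thesis using a b \<open>k \<noteq> 0\<close> by simp
qed

text \<open>The coefficient of cosh in the closed form; it equals
  \<open>(p + 1) * w * v 0 + 1\<close> for the function \<open>v\<close> below.\<close>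

definition amp :: "real \<Rightarrow> real \<Rightarrow> real" where
  "amp p w = sqrt (1 + (p + 1)\<^sup>2 / p * w)"

text \<open>For \<open>q = 2 p - 1\<close> and \<open>w > 0\<close> this is \<open>\<phi> powr (1 - p)\<close>, where \<open>\<phi>\<close> is the ground state.\<close>
definition recip_profile :: "real \<Rightarrow> real \<Rightarrow> real \<Rightarrow> real" where
  "recip_profile p w x = (amp p w * cosh ((p - 1) * sqrt w * x) - 1) / ((p + 1) * w)"

lemma amp_gt_1: "p > 1 \<Longrightarrow> w > 0 \<Longrightarrow> amp p w > 1"
  by (simp add: amp_def)

lemma amp_square: "p > 1 \<Longrightarrow> w > 0 \<Longrightarrow> (amp p w)\<^sup>2 = 1 + (p + 1)\<^sup>2 / p * w"
  by (simp add: amp_def)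

lemma recip_profile_pos:
  assumes "p > 1" "w > 0"
  shows "recip_profile p w x > 0"
proof -
  have "amp p w * cosh ((p - 1) * sqrt w * x) > 1 * 1"
    using amp_gt_1[OF assms] by (intro mult_less_le_imp_less) (auto simp: cosh_real_ge_1)
  then show ?thesis using assms by (simp add: recip_profile_def)
qed

lemma ground_state_imp_profile:
  assumes gs: "ground_state p (2 * p - 1) w f" and p: "p > 1" and w: "w > 0"
  shows "f = (\<lambda>x. recip_profile p w x powr (- 1 / (p - 1)))"
proof -
  note D = ground_state_derivs[OF gs]
  note en = ground_state_energy[OF gs]
  define v where "v = (\<lambda>x. f x powr (1 - p))"
  define v' where "v' = (\<lambda>x. (1 - p) * f x powr (- p) * deriv f x)"
  define k where "k = (p - 1) * sqrt w"
  \<comment> \<open>The shift that makes the affine equation for \<open>v\<close>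
    homogeneous.\<close>
  define c where "c = 1 / ((p + 1) * w)"
  have k: "k \<noteq> 0" "k\<^sup>2 = (p - 1)\<^sup>2 * w" using p w by (simp_all add: k_def power_mult_distrib)
  have c: "w * c = 1 / (p + 1)" using w by (simp add: c_def)
  have dv: "(v has_real_derivative v' x) (at x)" for x
    unfolding v_def v'_def using D(3)[of x]
    by (auto intro!: derivative_eq_intros D(1) simp: mult.commute)
  \<comment> \<open>The factor \<open>f x powr (p + 1)\<close> is taken out because it cancels
    against \<open>f x powr (- p - 1)\<close> in the second derivative of \<open>v\<close>, and
    because it is nonzero at 0.\<close>
  have en1: "(deriv f x)\<^sup>2 = f x powr (p + 1) * (w * v x + 2 / (p + 1) - f x powr (p - 1) / p)" for x
  proof -
    have "(f x)\<^sup>2 = f x powr (p + 1) * v x" "f x powr (2 * p) = f x powr (p + 1) * f x powr (p - 1)"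
      using D(3)[of x] by (simp_all add: v_def flip: powr_add powr_numeral)
    then show ?thesis using en[of x] p by (simp add: algebra_simps)
  qed
  \<comment> \<open>The energy identity eliminates \<open>(deriv f x)\<^sup>2\<close>. The exponent
    q = 2p - 1 makes the remaining nonlinear terms multiples of \<open>f x powr (p - 1)\<close>, and
    these cancel.\<close>
  have dv': "(v' has_real_derivative k\<^sup>2 * (v x + c)) (at x)" for x
  proof -
    have pos: "f x > 0" by (rule D)
    have e1: "f x powr (- p - 1) * f x powr (p + 1) = 1"
      "f x powr (- p) * f x = v x" "f x powr (- p) * f x powr p = 1"
      "f x powr (- p) * f x powr (2 * p - 1) = f x powr (p - 1)"
      using pos powr_add[of "f x" "-p" 1] by (simp_all add: v_def flip: powr_add)
    have "f x powr (- p - 1) * (deriv f x)\<^sup>2 = (f x powr (- p - 1) * f x powr (p + 1)) * (w * v x + 2 / (p + 1) - f x powr (p - 1) / p)"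
      unfolding en1 by (simp only: mult.assoc)
    then have e2: "f x powr (- p - 1) * (deriv f x)\<^sup>2 = w * v x + 2 / (p + 1) - f x powr (p - 1) / p"
      unfolding e1 by simp
    have e3: "f x powr (- p) * (w * f x + f x powr p - f x powr (2 * p - 1)) = w * v x + 1 - f x powr (p - 1)"
      using e1(2-4) by (simp add: algebra_simps)
    have "(v' has_real_derivative (1 - p) * (- p) * (f x powr (- p - 1) * (deriv f x)\<^sup>2)
        + (1 - p) * (f x powr (- p) * (w * f x + f x powr p - f x powr (2 * p - 1)))) (at x)"
      unfolding v'_def using pos
      by (auto intro!: derivative_eq_intros D(1,2) simp: power2_eq_square algebra_simps)
    also have "(1 - p) * (- p) * (f x powr (- p - 1) * (deriv f x)\<^sup>2)
        + (1 - p) * (f x powr (- p) * (w * f x + f x powr p - f x powr (2 * p - 1)))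
        = (p - 1)\<^sup>2 * (w * v x + 1 / (p + 1))"
      unfolding e2 e3 using p by (simp add: divide_simps) algebra
    also have "\<dots> = k\<^sup>2 * (v x + c)"
      unfolding k(2) c[symmetric] by (simp add: algebra_simps)
    finally show ?thesis .
  qed
  have f'0: "deriv f 0 = 0"
    using even_imp_deriv_0[OF _ D(1)] gs unfolding ground_state_def by blast
  have sol: "v x + c = (v 0 + c) * cosh (k * x)" for x
    by (rule cosh_ODE_unique[of "\<lambda>x. v x + c" v' k x])
       (use dv dv' k f'0 in \<open>auto intro!: derivative_eq_intros simp: v'_def\<close>)
  have v0: "v 0 > 0" using D(3)[of 0] by (simp add: v_def)
  \<comment> \<open>At 0 the left side of \<open>en1\<close> vanishes while the power in front does
    not, so the bracket is 0.\<close>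
  have "w * v 0 + 2 / (p + 1) - f 0 powr (p - 1) / p = 0"
    using en1[of 0] f'0 D(3)[of 0] by simp
  moreover have "f 0 powr (p - 1) = 1 / v 0"
    using D(3)[of 0] by (simp add: v_def powr_diff)
  ultimately have "v 0 * (w * v 0 + 2 / (p + 1) - 1 / v 0 / p) = 0" by simp
  moreover have "v 0 * (w * v 0 + 2 / (p + 1) - 1 / v 0 / p) = w * (v 0)\<^sup>2 + 2 / (p + 1) * v 0 - 1 / p"
    using v0 by (simp add: algebra_simps power2_eq_square)
  ultimately have root: "w * (v 0)\<^sup>2 + 2 / (p + 1) * v 0 = 1 / p" by linarith
  \<comment> \<open>Completing the square in the quadratic equation for \<open>v 0\<close>; since
    both bases are positive, taking roots selects the positive solution.\<close>
  have "((p + 1) * w * v 0 + 1)\<^sup>2 = (p + 1)\<^sup>2 * w * (w * (v 0)\<^sup>2 + 2 / (p + 1) * v 0) + 1"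
    using p by (simp add: divide_simps) algebra
  then have "((p + 1) * w * v 0 + 1)\<^sup>2 = (amp p w)\<^sup>2"
    unfolding amp_square[OF p w] root by simp
  then have "(p + 1) * w * v 0 + 1 = amp p w"
    by (rule power2_eq_imp_eq) (use v0 p w amp_gt_1[OF p w] in auto)
  then have "v 0 + c = amp p w / ((p + 1) * w)"
    using p w by (simp add: c_def divide_simps) (simp add: mult_ac)
  then have "v x = recip_profile p w x" for x
    using sol[of x] by (simp add: recip_profile_def k_def c_def diff_divide_distrib)
  moreover have "v x powr (- 1 / (p - 1)) = f x" for x
  proof -
    have "(1 - p) * (- 1 / (p - 1)) = 1" using p by (simp add: divide_simps)
    then show ?thesis
      unfolding v_def powr_powr using D(3)[of x] by simp
  qed
  ultimately show ?thesis by auto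
qed

section \<open>Existence of the ground state and evaluation of \<open>phi\<close>\<close>

text \<open>The substitution is run backwards: the linear equation \<open>dv'\<close> and the first
  integral \<open>en\<close> of \<open>v\<close> together give the nonlinear equation for
  \<open>v powr (- r)\<close>.\<close>

lemma profile_ground_state:
  assumes p: "p > 1" and w: "w > 0"
  shows "ground_state p (2 * p - 1) w (\<lambda>x. recip_profile p w x powr (- 1 / (p - 1)))"
proof -
  define v where "v = recip_profile p w"
  define r where "r = 1 / (p - 1)"
  define k where "k = (p - 1) * sqrt w"
  define S where "S = amp p w"
  define f where "f = (\<lambda>x. v x powr (- r))"
  have r: "r > 0" "r * (p - 1) = 1" using p by (simp_all add: r_def)
  have k: "k > 0" "k\<^sup>2 = (p - 1)\<^sup>2 * w" using p w by (simp_all add: k_def power_mult_distrib)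
  have S: "S > 1" "S\<^sup>2 = 1 + (p + 1)\<^sup>2 / p * w"
    unfolding S_def using amp_gt_1 amp_square p w by auto
  have v: "v = (\<lambda>x. (S * cosh (k * x) - 1) / ((p + 1) * w))"
    by (auto simp: v_def recip_profile_def S_def k_def)
  have vpos: "v x > 0" for x unfolding v_def by (rule recip_profile_pos[OF p w])
  define v' where "v' = (\<lambda>x. S * k * sinh (k * x) / ((p + 1) * w))"
  have dv: "(v has_real_derivative v' x) (at x)" for x
    unfolding v v'_def by (rule derivative_eq_intros refl)+ (use p w in auto)
  have dv': "(v' has_real_derivative (p - 1)\<^sup>2 * (w * v x + 1 / (p + 1))) (at x)" for x
  proof -
    have "(v' has_real_derivative k\<^sup>2 * S * cosh (k * x) / ((p + 1) * w)) (at x)"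
      unfolding v'_def by (rule derivative_eq_intros refl)+ (use p w in \<open>auto simp: power2_eq_square\<close>)
    also have "k\<^sup>2 * S * cosh (k * x) / ((p + 1) * w) = (p - 1)\<^sup>2 * (w * v x + 1 / (p + 1))"
      unfolding v k(2) using p w by (simp add: divide_simps)
    finally show ?thesis .
  qed
  \<comment> \<open>The second derivative of \<open>f\<close> contains
    \<open>(v' x)\<^sup>2\<close>, which has to become a polynomial in \<open>v x\<close>. This uses
    the relation between sinh and cosh, and the value of \<open>S\<^sup>2\<close> produces the
    constant term.\<close>
  have en: "(v' x)\<^sup>2 = (p - 1)\<^sup>2 * (w * (v x)\<^sup>2 + 2 / (p + 1) * v x - 1 / p)" for x
  proof -
    define C where "C = S * cosh (k * x)"
    have C: "v x = (C - 1) / ((p + 1) * w)" by (simp add: v C_def)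
    have "(v' x)\<^sup>2 = S\<^sup>2 * k\<^sup>2 * (sinh (k * x))\<^sup>2 / ((p + 1) * w)\<^sup>2"
      by (simp add: v'_def power_mult_distrib power_divide)
    also have "\<dots> = k\<^sup>2 * (C\<^sup>2 - S\<^sup>2) / ((p + 1) * w)\<^sup>2"
      by (simp add: C_def cosh_square_eq algebra_simps power_mult_distrib)
    also have "\<dots> = (p - 1)\<^sup>2 * (w * (C\<^sup>2 - 1 - (p + 1)\<^sup>2 / p * w) / ((p + 1) * w)\<^sup>2)"
      by (simp add: k(2) S(2) algebra_simps)
    also have "w * (C\<^sup>2 - 1 - (p + 1)\<^sup>2 / p * w) / ((p + 1) * w)\<^sup>2
      = w * (v x)\<^sup>2 + 2 / (p + 1) * v x - 1 / p"
      unfolding C using p w by (simp add: divide_simps) algebra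
    finally show ?thesis .
  qed
  define f' where "f' = (\<lambda>x. - r * v x powr (- r - 1) * v' x)"
  have df: "(f has_real_derivative f' x) (at x)" for x
    unfolding f_def f'_def using vpos[of x]
    by (auto intro!: derivative_eq_intros dv simp: mult_ac)
  then have f': "deriv f = f'" by (auto simp: DERIV_imp_deriv)
  have df': "(f' has_real_derivative (w * f x + f x powr p - f x powr (2 * p - 1))) (at x)" for x
  proof -
    have d: "(f' has_real_derivative (- r * (- r - 1) * (v x powr (- r - 2) * (v' x)\<^sup>2)
        - r * v x powr (- r - 1) * ((p - 1)\<^sup>2 * (w * v x + 1 / (p + 1))))) (at x)"
      unfolding f'_def using vpos[of x]
      by (auto intro!: derivative_eq_intros dv dv' simp: algebra_simps power2_eq_square)
    have rp: "r * p = r + 1" using r by (simp add: algebra_simps)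
    \<comment> \<open>Every power of \<open>f x\<close> in the equation is
      \<open>v x powr (- r - 2)\<close> times 1, \<open>v x\<close> or its square, which reduces the
      equation to a polynomial identity in \<open>v x\<close>.\<close>
    have "v x powr (- r) = v x powr (- r - 2 + 2)" by simp
    then have e1: "f x = v x powr (- r - 2) * (v x)\<^sup>2"
      unfolding powr_add f_def using vpos[of x] by simp
    have "v x powr (- r - 1) = v x powr (- r - 2 + 1)"
      by (rule arg_cong) simp
    then have e2: "v x powr (- r - 1) = v x powr (- r - 2) * v x"
      unfolding powr_add using vpos[of x] by simp
    have "- r * p = - r - 1" "- r * (2 * p - 1) = - r - 2"
      using rp by (simp_all add: algebra_simps)
    then have e3: "f x powr p = v x powr (- r - 2) * v x" "f x powr (2 * p - 1) = v x powr (- r - 2)"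
      unfolding f_def powr_powr by (simp_all only: e2)
    note e = e1 e2 e3
    have en': "(v x powr (- r - 2) * (v' x)\<^sup>2) = v x powr (- r - 2) * ((p - 1)\<^sup>2 * (w * (v x)\<^sup>2 + 2 / (p + 1) * v x - 1 / p))"
      by (simp only: en)
    have rp1: "r * (r + 1) * (p - 1)\<^sup>2 = p" "r * (p - 1)\<^sup>2 = p - 1"
      using r(2) by algebra+
    \<comment> \<open>With the power of \<open>v x\<close> and the other factors replaced by
      letters, the rearrangement is purely polynomial.\<close>
    have factor: "- r * (- r - 1) * (P * (Q * X)) - r * (P * z) * (Q * Y)
        = P * ((r * (r + 1) * Q) * X - (r * Q) * Y * z)" for P Q X Y z
      by algebra
    have "- r * (- r - 1) * (v x powr (- r - 2) * (v' x)\<^sup>2)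
        - r * v x powr (- r - 1) * ((p - 1)\<^sup>2 * (w * v x + 1 / (p + 1)))
      = v x powr (- r - 2) * ((r * (r + 1) * (p - 1)\<^sup>2) * (w * (v x)\<^sup>2 + 2 / (p + 1) * v x - 1 / p)
          - (r * (p - 1)\<^sup>2) * (w * v x + 1 / (p + 1)) * v x)"
      unfolding en' e(2) by (rule factor)
    \<comment> \<open>The coefficients combine as p - (p - 1) = 1, (2p - (p - 1))/(p + 1) = 1 and
      -1.\<close>
    also have "\<dots> = v x powr (- r - 2) * (w * (v x)\<^sup>2 + v x - 1)"
      unfolding rp1 using p by (simp add: divide_simps) algebra
    also have "\<dots> = w * f x + f x powr p - f x powr (2 * p - 1)"
      unfolding e(3,4) unfolding e(1) by (simp add: algebra_simps)
    finally show ?thesis using d by simp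
  qed
  have "f differentiable (at x)" "deriv f differentiable (at x)" for x
    using df df' unfolding f' by (auto simp: real_differentiable_def)
  moreover have "- deriv (deriv f) x + w * f x
            + \<bar>f x\<bar> powr (p - 1) * f x - \<bar>f x\<bar> powr (2 * p - 1 - 1) * f x = 0" for x
  proof -
    have pos: "f x > 0" using vpos[of x] by (simp add: f_def)
    then have "f x powr (a - 1) * f x = f x powr a" for a by (simp add: powr_diff)
    moreover have "deriv (deriv f) x = w * f x + f x powr p - f x powr (2 * p - 1)"
      unfolding f' by (rule DERIV_imp_deriv[OF df'])
    ultimately show ?thesis
      unfolding abs_of_pos[OF pos] by (simp only:)
  qed
  moreover have "f x > 0" for x
    using vpos[of x] by (simp add: f_def)
  moreover have "f (- x) = f x" for x
    by (simp add: f_def v)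
  moreover have "strict_antimono_on {0..} f"
  proof (rule monotone_onI)
    fix x y :: real assume "x \<in> {0..}" "y \<in> {0..}" "x < y"
    then have "cosh (k * x) < cosh (k * y)"
      using k by (intro cosh_real_strict_mono) auto
    then have "v x < v y" using p w S by (simp add: v divide_strict_right_mono)
    then show "f x > f y" using vpos r unfolding f_def by (intro powr_less_mono2_neg) auto
  qed
  moreover have "(f \<longlongrightarrow> 0) at_infinity"
  proof -
    have "filterlim v at_top at_top"
      unfolding v using k S p w by real_asymp
    then have t: "(f \<longlongrightarrow> 0) at_top"
      unfolding f_def using r by (intro tendsto_neg_powr) auto
    have "(f \<longlongrightarrow> 0) at_bot"
      using filterlim_compose[OF t filterlim_uminus_at_top_at_bot] by (simp add: f_def v)
    with t show ?thesis by (simp add: at_infinity_eq_at_top_bot filterlim_sup)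
  qed
  ultimately have "ground_state p (2 * p - 1) w f"
    unfolding ground_state_def by blast
  then show ?thesis by (simp add: f_def v_def r_def)
qed

text \<open>Existence and uniqueness together determine the definite description.\<close>

lemma phi_eq:
  assumes "p > 1" "w > 0"
  shows "phi p (2 * p - 1) w x = recip_profile p w x powr (- 1 / (p - 1))"
proof -
  have "phi p (2 * p - 1) w = (\<lambda>x. recip_profile p w x powr (- 1 / (p - 1)))"
    unfolding phi_def
    using profile_ground_state[OF assms] ground_state_imp_profile[OF _ assms] by (rule the_equality)
  then show ?thesis by simp
qed

section \<open>The derivative in w and its limit as w decreases to 0\<close>

text \<open>The quotient rule applied to
  \<open>(sqrt (1 + a * w) * cosh (s * sqrt w) - 1) / w\<close>, which is
  \<open>(p + 1) * recip_profile p w x\<close> for a = (p + 1)^2 / p and s = (p - 1) x.\<close>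

definition dprofile :: "real \<Rightarrow> real \<Rightarrow> real \<Rightarrow> real" where
  "dprofile a s w = ((a / (2 * sqrt (1 + a * w)) * cosh (s * sqrt w)
     + sqrt (1 + a * w) * sinh (s * sqrt w) * s / (2 * sqrt w)) / w
     - (sqrt (1 + a * w) * cosh (s * sqrt w) - 1) / w\<^sup>2)"

text \<open>The limit is the w^2 coefficient of the product of sqrt(1 + a w) = 1 + a w/2 - a^2 w^2/8
  + ... and cosh(s sqrt w) = 1 + s^2 w/2 + s^4 w^2/24 + ...\<close>

lemma dprofile_limit:
  assumes "a > 0"
  shows "(dprofile a s \<longlongrightarrow> s ^ 4 / 24 + a * s\<^sup>2 / 4 - a\<^sup>2 / 8) (at_right 0)"
proof -
  \<comment> \<open>The expansion is computed with the sign of \<open>s\<close> fixed;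
    \<open>s = 0\<close> is treated separately and negative \<open>s\<close> follows by
    evenness.\<close>
  have pos: "(dprofile a s \<longlongrightarrow> s ^ 4 / 24 + a * s\<^sup>2 / 4 - a\<^sup>2 / 8) (at_right 0)" if "s > 0" for s
    unfolding dprofile_def using assms that by real_asymp (simp add: field_simps power2_eq_square power4_eq_xxxx)
  have z: "(dprofile a 0 \<longlongrightarrow> - a\<^sup>2 / 8) (at_right 0)"
    unfolding dprofile_def using assms by simp (real_asymp, simp add: power2_eq_square)
  have "dprofile a (-s) = dprofile a s" by (auto simp: dprofile_def)
  then show ?thesis
    using pos[of s] pos[of "-s"] z by (cases s "0::real" rule: linorder_cases) auto
qed

text \<open>The same expansion one order lower: the w coefficient is (a + s^2)/2. The limit is
  \<phi>_0(x)^(1 - p) for the known profile \<phi>_0.\<close>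

lemma recip_profile_limit:
  assumes "p > 1"
  shows "((\<lambda>w. recip_profile p w x) \<longlongrightarrow> ((p + 1)\<^sup>2 / p + (p - 1)\<^sup>2 * x\<^sup>2) / (2 * (p + 1))) (at_right 0)"
proof -
  define a s where "a = (p + 1)\<^sup>2 / p" and "s = (p - 1) * x"
  have a: "a > 0" using assms by (simp add: a_def)
  define h where "h = (\<lambda>s w. (sqrt (1 + a * w) * cosh (s * sqrt w) - 1) / w)"
  have pos: "(h s \<longlongrightarrow> (a + s\<^sup>2) / 2) (at_right 0)" if "s > 0" for s
    unfolding h_def using a that by real_asymp (simp add: power2_eq_square add_divide_distrib)
  have z: "(h 0 \<longlongrightarrow> a / 2) (at_right 0)"
    unfolding h_def using a by simp real_asymp
  have "h (-s) = h s" by (auto simp: h_def)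
  then have "(h s \<longlongrightarrow> (a + s\<^sup>2) / 2) (at_right 0)"
    using pos[of s] pos[of "-s"] z by (cases s "0::real" rule: linorder_cases) auto
  then have "((\<lambda>w. h s w / (p + 1)) \<longlongrightarrow> (a + s\<^sup>2) / 2 / (p + 1)) (at_right 0)"
    using assms by (intro tendsto_intros) auto
  moreover have "h s w / (p + 1) = recip_profile p w x" for w
    by (simp add: h_def recip_profile_def amp_def a_def s_def mult_ac)
  ultimately show ?thesis
    by (simp add: a_def s_def power_mult_distrib)
qed

lemma recip_profile_deriv:
  assumes p: "p > 1" and w: "w > 0"
  shows "((\<lambda>w. recip_profile p w x) has_real_derivative
           dprofile ((p + 1)\<^sup>2 / p) ((p - 1) * x) w / (p + 1)) (at w)"
proof -
  define a s where "a = (p + 1)\<^sup>2 / p" and "s = (p - 1) * x"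
  have a: "a > 0" using assms by (simp add: a_def)
  then have aw: "1 + a * w > 0" using w by (simp add: add_pos_pos)
  have "((\<lambda>w. (sqrt (1 + a * w) * cosh (s * sqrt w) - 1) / w) has_real_derivative
           dprofile a s w) (at w)"
    unfolding dprofile_def using w aw
    by (auto intro!: derivative_eq_intros) (simp add: divide_simps power2_eq_square mult_ac)
  then have "((\<lambda>w. (sqrt (1 + a * w) * cosh (s * sqrt w) - 1) / w / (p + 1)) has_real_derivative
           dprofile a s w / (p + 1)) (at w)"
    by (rule DERIV_cdivide)
  moreover have "(\<lambda>w. recip_profile p w x) = (\<lambda>w. (sqrt (1 + a * w) * cosh (s * sqrt w) - 1) / w / (p + 1))"
    by (auto simp: recip_profile_def amp_def a_def s_def mult_ac)
  ultimately show ?thesis unfolding a_def s_def by simp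
qed

lemma eta_eq:
  assumes p: "p > 1" and w: "w > 0"
  shows "eta p (2 * p - 1) w x =
    - 1 / (p - 1) * recip_profile p w x powr (- (1 / (p - 1) + 1))
      * (dprofile ((p + 1)\<^sup>2 / p) ((p - 1) * x) w / (p + 1))"
proof -
  let ?g = "\<lambda>w. recip_profile p w x powr (- 1 / (p - 1))"
  \<comment> \<open>The closed form is available for positive parameters, hence on a neighbourhood
    of \<open>w\<close>, which is enough for the derivative.\<close>
  have "\<forall>\<^sub>F w in nhds w. phi p (2 * p - 1) w x = ?g w"
    using eventually_nhds_in_open[of "{0<..}" w] w
    by (auto elim!: eventually_mono simp: phi_eq[OF p])
  then have "eta p (2 * p - 1) w x = deriv ?g w"
    unfolding eta_def by (rule deriv_cong_ev) simp
  also have "\<dots> = - 1 / (p - 1) * recip_profile p w x powr (- 1 / (p - 1) - 1)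
      * (dprofile ((p + 1)\<^sup>2 / p) ((p - 1) * x) w / (p + 1))"
    by (rule DERIV_imp_deriv)
       (use recip_profile_pos[OF p w, of x] p in
         \<open>auto intro!: derivative_eq_intros recip_profile_deriv[OF p w] simp: mult_ac\<close>)
  also have "- 1 / (p - 1) - 1 = - (1 / (p - 1) + 1)" by simp
  finally show ?thesis .
qed

text \<open>Both factors in the formula for \<open>eta\<close> converge as w decreases to 0. The
  limit \<open>V\<close> of the profile is positive, so the negative power is continuous
  there.\<close>

lemma eta0_eq:
  assumes p: "p > 1"
  shows "eta0 p (2 * p - 1) x =
            1 / ((p - 1) * (p + 1))
            * (2 * (p + 1) / ((p + 1)^2 / p + (p - 1)^2 * x^2)) powr (1 / (p - 1) + 1)
            * ((p + 1)^4 / (8 * p^2) - (p - 1)^2 * (p + 1)^2 / (4 * p) * x^2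
               - (p - 1)^4 / 24 * x^4)"
proof -
  define a s where "a = (p + 1)\<^sup>2 / p" and "s = (p - 1) * x"
  define V where "V = (a + (p - 1)\<^sup>2 * x\<^sup>2) / (2 * (p + 1))"
  have a: "a > 0" using assms by (simp add: a_def)
  then have V: "V > 0" using p by (simp add: V_def add_pos_nonneg)
  have "((\<lambda>w. - 1 / (p - 1) * recip_profile p w x powr (- (1 / (p - 1) + 1)) * (dprofile a s w / (p + 1)))
     \<longlongrightarrow> - 1 / (p - 1) * V powr (- (1 / (p - 1) + 1)) * ((s ^ 4 / 24 + a * s\<^sup>2 / 4 - a\<^sup>2 / 8) / (p + 1))) (at_right 0)"
    using p V a unfolding V_def a_def
    by (intro tendsto_intros recip_profile_limit dprofile_limit) auto
  moreover have "\<forall>\<^sub>F w in at_right 0. - 1 / (p - 1) * recip_profile p w x powr (- (1 / (p - 1) + 1)) * (dprofile a s w / (p + 1))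
      = eta p (2 * p - 1) w x"
    using eventually_at_right_less[of 0] eta_eq[OF p] unfolding a_def s_def
    by (auto elim!: eventually_mono)
  ultimately have lim: "((\<lambda>w. eta p (2 * p - 1) w x)
     \<longlongrightarrow> - 1 / (p - 1) * V powr (- (1 / (p - 1) + 1)) * ((s ^ 4 / 24 + a * s\<^sup>2 / 4 - a\<^sup>2 / 8) / (p + 1))) (at_right 0)"
    by (rule Lim_transform_eventually)
  have "V powr (- (1 / (p - 1) + 1)) = (1 / V) powr (1 / (p - 1) + 1)"
    using V powr_minus[of V "1 / (p - 1) + 1"] by (simp add: powr_divide inverse_eq_divide)
  also have "1 / V = 2 * (p + 1) / (a + (p - 1)\<^sup>2 * x\<^sup>2)" by (simp add: V_def)
  finally have "eta0 p (2 * p - 1) x = - 1 / (p - 1) * (2 * (p + 1) / (a + (p - 1)\<^sup>2 * x\<^sup>2)) powr (1 / (p - 1) + 1)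
      * ((s ^ 4 / 24 + a * s\<^sup>2 / 4 - a\<^sup>2 / 8) / (p + 1))"
    using tendsto_Lim[OF _ lim] unfolding eta0_def by simp
  \<comment> \<open>The minus sign from the exponent -1/(p - 1) moves into the polynomial.\<close>
  also have "\<dots> = 1 / ((p - 1) * (p + 1)) * (2 * (p + 1) / (a + (p - 1)\<^sup>2 * x\<^sup>2)) powr (1 / (p - 1) + 1)
      * (a\<^sup>2 / 8 - a * s\<^sup>2 / 4 - s ^ 4 / 24)"
    using p by (simp add: divide_simps) (simp add: algebra_simps)
  also have "a\<^sup>2 / 8 - a * s\<^sup>2 / 4 - s ^ 4 / 24 = (p + 1)^4 / (8 * p^2) - (p - 1)^2 * (p + 1)^2 / (4 * p) * x^2
               - (p - 1)^4 / 24 * x^4"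
    using p by (simp add: a_def s_def power_mult_distrib power_divide mult_ac)
  finally show ?thesis by (simp add: a_def)
qed

section \<open>Behaviour for large |x|\<close>

text \<open>In z = x^2 the power decays like (A/B)^(r + 1) z^(-r - 1) and the polynomial behaves
  like -F z^2, while the comparison function is -z^(1 - r). The quotient therefore tends to C
  (A/B)^(r + 1) F, which is positive.\<close>

lemma rational_profile_asymp:
  fixes r A a B C D E F :: real
  assumes "a > 0" "A > 0" "B > 0" "C > 0" "F > 0"
  shows "asymp_comparable
    (\<lambda>x. C * (A / (a + B * x\<^sup>2)) powr (r + 1) * (D - E * x\<^sup>2 - F * x ^ 4))
    (\<lambda>x. - (\<bar>x\<bar> powr (- 2 * r + 2))) at_infinity"
proof -
  \<comment> \<open>The quotient in the variable z, with z^(-r - 1) and -z^2 already cancelled, so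
    that its limit is found termwise.\<close>
  let ?h = "\<lambda>z. C * (A / (a / z + B)) powr (r + 1) * (F + E / z - D / z\<^sup>2)"
  have "filterlim (\<lambda>x::real. x\<^sup>2) at_top at_infinity"
    unfolding at_infinity_eq_at_top_bot by (intro filterlim_sup) real_asymp+
  moreover have "(?h \<longlongrightarrow> C * (A / (0 + B)) powr (r + 1) * (F + 0 - 0)) at_top"
    using assms by (intro tendsto_intros) (auto, real_asymp+)
  ultimately have "((\<lambda>x. ?h (x\<^sup>2)) \<longlongrightarrow> C * (A / (0 + B)) powr (r + 1) * (F + 0 - 0)) at_infinity"
    by (rule filterlim_compose[rotated])
  moreover have "\<forall>\<^sub>F x in at_infinity. ?h (x\<^sup>2) =
     C * (A / (a + B * x\<^sup>2)) powr (r + 1) * (D - E * x\<^sup>2 - F * x ^ 4) / (- (\<bar>x\<bar> powr (- 2 * r + 2)))"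
  proof (rule eventually_mono[OF eventually_not_equal_at_infinity[of 0]])
    fix x :: real assume x: "x \<noteq> 0"
    have e: "\<bar>x\<bar> powr (- 2 * r + 2) = x ^ 4 / (x\<^sup>2) powr (r + 1)"
    proof -
      have "(x\<^sup>2) powr (r + 1) = \<bar>x\<bar> powr (2 * (r + 1))"
        using x by (metis abs_ge_zero power2_abs powr_powr powr_numeral zero_less_abs_iff)
      moreover have "x ^ 4 = \<bar>x\<bar> powr 4" using x by simp
      moreover have "\<bar>x\<bar> powr (- 2 * r + 2) = \<bar>x\<bar> powr 4 / \<bar>x\<bar> powr (2 * (r + 1))"
        unfolding powr_diff[symmetric] by (simp add: algebra_simps)
      ultimately show ?thesis by simp
    qed
    have pos: "a + B * x\<^sup>2 > 0" using assms by (simp add: add_pos_nonneg)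
    have "A / (a / x\<^sup>2 + B) = A / (a + B * x\<^sup>2) * x\<^sup>2"
      using x by (simp add: field_simps)
    then have p: "(A / (a / x\<^sup>2 + B)) powr (r + 1) = (A / (a + B * x\<^sup>2)) powr (r + 1) * (x\<^sup>2) powr (r + 1)"
      using pos assms by (simp only: powr_mult)
    show "?h (x\<^sup>2) =
     C * (A / (a + B * x\<^sup>2)) powr (r + 1) * (D - E * x\<^sup>2 - F * x ^ 4) / (- (\<bar>x\<bar> powr (- 2 * r + 2)))"
      unfolding p e using x by (simp add: field_simps power2_eq_square power4_eq_xxxx)
  qed
  ultimately have "((\<lambda>x. C * (A / (a + B * x\<^sup>2)) powr (r + 1) * (D - E * x\<^sup>2 - F * x ^ 4)
     / (- (\<bar>x\<bar> powr (- 2 * r + 2)))) \<longlongrightarrow> C * (A / (0 + B)) powr (r + 1) * (F + 0 - 0)) at_infinity"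
    by (rule Lim_transform_eventually)
  then show ?thesis
    unfolding asymp_comparable_def using assms by (intro exI[of _ "C * (A / (0 + B)) powr (r + 1) * (F + 0 - 0)"]) auto
qed

theorem theoremA1:
  fixes p q :: real
  assumes "p > 1" and "q = 2 * p - 1"
  shows "(\<forall>x::real. eta0 p q x =
            1 / ((p - 1) * (p + 1))
            * (2 * (p + 1) / ((p + 1)^2 / p + (p - 1)^2 * x^2)) powr (1 / (p - 1) + 1)
            * ((p + 1)^4 / (8 * p^2) - (p - 1)^2 * (p + 1)^2 / (4 * p) * x^2
               - (p - 1)^4 / 24 * x^4))
       \<and> asymp_comparable (eta0 p q) (\<lambda>x. - (\<bar>x\<bar> powr (- 2 / (p - 1) + 2))) at_infinity"
proof -
  have fst: "eta0 p q x =
            1 / ((p - 1) * (p + 1))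
            * (2 * (p + 1) / ((p + 1)^2 / p + (p - 1)^2 * x^2)) powr (1 / (p - 1) + 1)
            * ((p + 1)^4 / (8 * p^2) - (p - 1)^2 * (p + 1)^2 / (4 * p) * x^2
               - (p - 1)^4 / 24 * x^4)" for x
    unfolding assms(2) by (rule eta0_eq[OF assms(1)])
  \<comment> \<open>The exponent is written with \<open>1 / (p - 1)\<close> in the role of
    \<open>r\<close>; the quartic coefficient (p - 1)^4 / 24 is the positive
    \<open>F\<close>.\<close>
  have "asymp_comparable (eta0 p q) (\<lambda>x. - (\<bar>x\<bar> powr (- 2 * (1 / (p - 1)) + 2))) at_infinity"
    unfolding fst using assms(1) by (intro rational_profile_asymp) auto
  then show ?thesis using fst by simp
qed


end
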